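(* Let $n\ge 1$ and $m\ge 1$ be integers, and let $P_m(w)$ denote the probability that a shelf shuffle with $m$ shelves of a deck of $n$ cards produces the permutation $w\in S_n$. Then for every $w\in S_n$, \[ P_m(w)=\frac{4^{v(w)+1}}{2(2m)^n}\sum_{a=0}^{m-1}\binom{n+m-a-1}{n}\binom{n-1-2v(w)}{a-v(w)}, \] where $v(w)$ is the number of valleys of $w$. Equivalently, $P_m(w)$ is the coefficient of $t^m$ in the power series \[ \frac{1}{2(2m)^n}\,\frac{(1+t)^{n+1}}{(1-t)^{n+1}}\left(\frac{4t}{(1+t)^2}\right)^{v(w)+1}. \]
   Context: Shelf shuffle with $m$ shelves of a deck of $n$ cards, initially in order $1,2,\dots,n$ from top to bottom: each card independently receives a label chosen uniformly at random from $\{1,2,\dots,2m\}$. The new deck is formed by placing, from top to bottom, first the cards labeled $1$ in increasing order, then the cards labeled $2$ in decreasing order, then the cards labeled $3$ in increasing order, and so on: the packet of cards with label $j$ is in increasing order if $j$ is odd and in decreasing order if $j$ is even (empty packets are allowed and still count in this alternation). The outcome is recorded as the permutation $w\in S_n$ where $w(i)$ is the card in position $i$ from the top. A valley of $w\in S_n$ is an index $i$ with $1<i<n$ and $w(i-1)>w(i)<w(i+1)$. Binomial coefficients $\binom{k}{j}$ are taken to be $0$ unless $0\le j\le k$. *)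

theory Defs
  imports
    "HOL-Probability.Probability"
    "HOL-Combinatorics.Permutations"
    "HOL-Computational_Algebra.Formal_Power_Series"
begin

definition packet :: "nat \<Rightarrow> (nat \<Rightarrow> nat) \<Rightarrow> nat \<Rightarrow> nat list" where
  "packet n f j =
     (let cards = filter (\<lambda>c. f c = j) [1..<Suc n]
      in if odd j then cards else rev cards)"

definition shelf_deck :: "nat \<Rightarrow> nat \<Rightarrow> (nat \<Rightarrow> nat) \<Rightarrow> nat list" where
  "shelf_deck m n f = concat (map (packet n f) [1..<Suc (2 * m)])"

text \<open>Positions are counted from 1, list indices from 0. The permutation is the
  identity outside \<open>{1..n}\<close>, as required by \<^const>\<open>permutes\<close>.\<close>
definition shelf_perm :: "nat \<Rightarrow> nat \<Rightarrow> (nat \<Rightarrow> nat) \<Rightarrow> nat \<Rightarrow> nat" where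
  "shelf_perm m n f = (\<lambda>i. if i \<in> {1..n} then shelf_deck m n f ! (i - 1) else i)"

text \<open>The 0 is the value of a labelling outside \<open>{1..n}\<close>, which plays no role.
  Since \<^const>\<open>pmf_of_set\<close> is unspecified on the empty set, this is meaningful
  only for \<open>m \<ge> 1\<close>.\<close>
definition shelf_shuffle :: "nat \<Rightarrow> nat \<Rightarrow> (nat \<Rightarrow> nat) pmf" where
  "shelf_shuffle m n =
     map_pmf (shelf_perm m n) (Pi_pmf {1..n} 0 (\<lambda>_. pmf_of_set {1..2 * m}))"

definition valleys :: "nat \<Rightarrow> (nat \<Rightarrow> nat) \<Rightarrow> nat" where
  "valleys n w = card {i. 1 < i \<and> i < n \<and> w (i - 1) > w i \<and> w i < w (i + 1)}"

text \<open>Integer arguments avoid truncated subtraction in the lower index.\<close>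
definition int_binomial :: "int \<Rightarrow> int \<Rightarrow> nat" where
  "int_binomial k j = (if 0 \<le> j \<and> j \<le> k then nat k choose nat j else 0)"

end

theory Submission
  imports Defs
begin

text \<open>Reading the labels along the positions of \<open>w\<close> turns the labellings that produce \<open>w\<close> into weakly
  increasing words, where equal neighbours are allowed only at ascents (odd labels) or only at
  descents (even labels). Mark words of length \<open>i\<close> ending in \<open>2 * k - 1\<close> or \<open>2 * k\<close> by \<open>t ^ k\<close>,
  and let \<open>O\<close> and \<open>E\<close> be the generating functions for odd and even last labels. After an ascent
  \<open>O = E\<close>, after a descent \<open>O = t * E\<close>, so that each position multiplies \<open>E\<close> by a factor depending
  only on two consecutive steps: \<open>(1 + t) / (1 - t)\<close> if they agree, \<open>2 / (1 - t)\<close> at a peak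
  and \<open>2 * t / (1 - t)\<close> at a valley. Adding an initial ascent and a final descent makes
  the number of peaks one more than the number of valleys, which gives the product formula.\<close>

section \<open>Counting label chains by their last label\<close>

definition step :: "bool \<Rightarrow> nat \<Rightarrow> nat \<Rightarrow> bool" where
  "step b x y \<longleftrightarrow> x < y \<or> x = y \<and> b = odd x"

text \<open>Vanishing beyond \<open>i\<close> makes a chain determined by its entries up to
  \<open>i\<close>, so that counting functions counts words. The flag \<open>up j\<close> governs
  the step from position \<open>j\<close> to \<open>Suc j\<close>.\<close>

definition label_chains :: "(nat \<Rightarrow> bool) \<Rightarrow> nat \<Rightarrow> nat \<Rightarrow> (nat \<Rightarrow> nat) set" where
  "label_chains up i k =
     {g. g 0 = 1 \<and> g i = k \<and> (\<forall>j<i. step (up j) (g j) (g (Suc j))) \<and> (\<forall>j>i. g j = 0)}"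

fun chain_count :: "(nat \<Rightarrow> bool) \<Rightarrow> nat \<Rightarrow> nat \<Rightarrow> nat" where
  "chain_count up 0 k = (if k = 1 then 1 else 0)"
| "chain_count up (Suc i) k =
     (\<Sum>j<k. chain_count up i j) + (if up i = odd k then chain_count up i k else 0)"

lemma label_chains_Suc:
  "label_chains up (Suc i) k = (\<Union>j\<in>{j. step (up i) j k}. (\<lambda>g. g(Suc i := k)) ` label_chains up i j)"
proof (intro equalityI subsetI)
  fix g assume g: "g \<in> label_chains up (Suc i) k"
  define h where "h = g(Suc i := 0)"
  have "h \<in> label_chains up i (g i)"
    using g unfolding label_chains_def h_def by (auto simp: less_Suc_eq)
  moreover have "g = h(Suc i := k)"
    using g by (auto simp: h_def label_chains_def)
  moreover have "step (up i) (g i) k"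
    using g by (auto simp: label_chains_def)
  ultimately show "g \<in> (\<Union>j\<in>{j. step (up i) j k}. (\<lambda>g. g(Suc i := k)) ` label_chains up i j)"
    by blast
qed (auto simp: label_chains_def less_Suc_eq)

lemma step_predecessors:
  "{j. step b j k} = {..<k} \<union> (if b = odd k then {k} else {})"
  by (auto simp: step_def)

text \<open>Removing the last entry gives the recursion. Appending \<open>k\<close> is injective
  because chains vanish at \<open>Suc i\<close>, and chains with different entries at
  \<open>i\<close> stay different since that entry is not touched.\<close>

lemma card_label_chains: "finite (label_chains up i k) \<and> card (label_chains up i k) = chain_count up i k"
proof (induction i arbitrary: k)
  case 0
  have "label_chains up 0 k = (if k = 1 then {(\<lambda>j. if j = 0 then 1 else 0)} else {})"
    by (auto simp: label_chains_def fun_eq_iff)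
  then show ?case by simp
next
  case (Suc i)
  let ?J = "{j. step (up i) j k}" and ?u = "\<lambda>g. g(Suc i := k)"
  have inj: "inj_on ?u (label_chains up i j)" for j
  proof (rule inj_onI)
    fix g h assume gh: "g \<in> label_chains up i j" "h \<in> label_chains up i j" and eq: "?u g = ?u h"
    have "g x = h x" for x
      using gh fun_cong[OF eq, of x] by (cases "x = Suc i") (auto simp: label_chains_def)
    then show "g = h" by blast
  qed
  have disj: "?u ` label_chains up i j \<inter> ?u ` label_chains up i j' = {}" if "j \<noteq> j'" for j j'
  proof (rule ccontr)
    assume "?u ` label_chains up i j \<inter> ?u ` label_chains up i j' \<noteq> {}"
    then obtain g h where "g i = j" "h i = j'" "?u g = ?u h"
      by (auto simp: label_chains_def)
    then show False using that by (metis fun_upd_other n_not_Suc_n)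
  qed
  have fin: "finite ?J" by (simp add: step_predecessors)
  have "card (label_chains up (Suc i) k) = (\<Sum>j\<in>?J. card (?u ` label_chains up i j))"
    unfolding label_chains_Suc using Suc.IH fin disj by (intro card_UN_disjoint) auto
  also have "\<dots> = (\<Sum>j\<in>?J. chain_count up i j)"
    using Suc.IH inj by (simp add: card_image)
  also have "\<dots> = chain_count up (Suc i) k"
    by (simp add: step_predecessors)
  finally show ?case
    using Suc.IH fin by (auto simp: label_chains_Suc)
qed

section \<open>Recurrences for the generating functions\<close>

definition even_gf :: "(nat \<Rightarrow> bool) \<Rightarrow> nat \<Rightarrow> real fps" where
  "even_gf up i = Abs_fps (\<lambda>m. real (chain_count up i (2 * m)))"

text \<open>The constant coefficient is \<open>chain_count up i 0 = 0\<close>, by truncated subtraction.\<close>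
definition odd_gf :: "(nat \<Rightarrow> bool) \<Rightarrow> nat \<Rightarrow> real fps" where
  "odd_gf up i = Abs_fps (\<lambda>m. real (chain_count up i (2 * m - 1)))"

lemma chain_count_0_right [simp]: "chain_count up i 0 = 0"
  by (induction i) auto

text \<open>Multiplication by \<open>1 - fps_X\<close> takes differences of the counts for last
  labels \<open>2 * k + 2\<close> and \<open>2 * k\<close>. The cumulative sums telescope to two
  terms: the predecessors \<open>2 * k\<close> and \<open>2 * k + 1\<close> after an ascent,
  \<open>2 * k + 1\<close> and \<open>2 * k + 2\<close> after a descent.\<close>

lemma even_gf_Suc:
  "(1 - fps_X) * even_gf up (Suc i) =
     odd_gf up i + (if up i then fps_X * even_gf up i else even_gf up i)"
proof (rule fps_ext)
  fix k
  show "fps_nth ((1 - fps_X) * even_gf up (Suc i)) k =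
     fps_nth (odd_gf up i + (if up i then fps_X * even_gf up i else even_gf up i)) k"
    by (cases k) (auto simp: even_gf_def odd_gf_def left_diff_distrib)
qed

text \<open>After an ascent, the last labels \<open>2 * k - 1\<close> and \<open>2 * k\<close> both
  admit exactly the predecessors below \<open>2 * k\<close>. After a descent,
  \<open>2 * k - 1\<close> and \<open>2 * k - 2\<close> both admit exactly those below
  \<open>2 * k - 1\<close>.\<close>

lemma odd_gf_Suc:
  "odd_gf up (Suc i) = (if up i then even_gf up (Suc i) else fps_X * even_gf up (Suc i))"
proof (rule fps_ext)
  fix k
  show "fps_nth (odd_gf up (Suc i)) k =
     fps_nth (if up i then even_gf up (Suc i) else fps_X * even_gf up (Suc i)) k"
    by (cases k) (auto simp: even_gf_def odd_gf_def)
qed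

section \<open>Closed form in terms of the number of turns\<close>

definition turns :: "(nat \<Rightarrow> bool) \<Rightarrow> nat \<Rightarrow> nat" where
  "turns up i = card {j. j < i \<and> \<not> up j \<and> up (Suc j)}"

lemma turns_0 [simp]: "turns up 0 = 0"
  by (simp add: turns_def)

lemma turns_Suc: "turns up (Suc i) = turns up i + (if \<not> up i \<and> up (Suc i) then 1 else 0)"
proof -
  have "{j. j < Suc i \<and> \<not> up j \<and> up (Suc j)} = {j. j < i \<and> \<not> up j \<and> up (Suc j)} \<union>
      (if \<not> up i \<and> up (Suc i) then {i} else {})"
    by (auto simp: less_Suc_eq)
  then show ?thesis by (simp add: turns_def)
qed

text \<open>Peaks and valleys alternate, starting with a peak: there are as many peaks as valleys
  while the last step is an ascent, and one more after a descent. Each peak-valley pair contributes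
  \<open>4 * fps_X\<close>, an unpaired peak contributes \<open>2\<close>, and the remaining pairs
  of consecutive steps contribute \<open>1 + fps_X\<close>. The inequalities keep the truncated
  subtractions in the exponents exact.\<close>

lemma even_gf_closed_form:
  fixes up i
  defines "v \<equiv> turns up i"
  assumes "up 0"
  shows "if up i
    then 2 * v \<le> i \<and> (1 - fps_X) ^ Suc i * even_gf up (Suc i) =
           fps_X * (4 * fps_X) ^ v * (1 + fps_X) ^ (i - 2 * v)
    else 2 * v + 1 \<le> i \<and> (1 - fps_X) ^ Suc i * even_gf up (Suc i) =
           2 * fps_X * (4 * fps_X) ^ v * (1 + fps_X) ^ (i - 1 - 2 * v)"
  unfolding v_def
proof (induction i)
  case 0
  \<comment> \<open>At position 0 only label 1 occurs, and \<open>2 * m - 1 = 1\<close> exactly for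
    \<open>m = 1\<close>.\<close>
  have "odd_gf up 0 = fps_X" "even_gf up 0 = 0"
    by (auto simp: fps_eq_iff odd_gf_def even_gf_def; presburger)+
  then show ?case using \<open>up 0\<close> even_gf_Suc[of up 0] by simp
next
  case (Suc i)
  let ?E = "(1 - fps_X) ^ Suc i * even_gf up (Suc i)" and ?v = "turns up i"
  have "(1 - fps_X) ^ Suc (Suc i) * even_gf up (Suc (Suc i)) =
    (1 - fps_X) ^ Suc i * ((1 - fps_X) * even_gf up (Suc (Suc i)))"
    by (simp only: power_Suc mult_ac)
  also have "(1 - fps_X) * even_gf up (Suc (Suc i)) =
     ((if up i then 1 else fps_X) + (if up (Suc i) then fps_X else 1)) * even_gf up (Suc i)"
    unfolding even_gf_Suc[of up "Suc i"] odd_gf_Suc by (simp add: distrib_right)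
  finally have rec: "(1 - fps_X) ^ Suc (Suc i) * even_gf up (Suc (Suc i)) =
     ((if up i then 1 else fps_X) + (if up (Suc i) then fps_X else 1)) * ?E"
    by (simp only: mult_ac)
  show ?case
  proof (cases "up i")
    case True
    then have le: "2 * ?v \<le> i"
      and E: "?E = fps_X * (4 * fps_X) ^ ?v * (1 + fps_X) ^ (i - 2 * ?v)"
      using Suc.IH by auto
    from le have "Suc i - 2 * ?v = Suc (i - 2 * ?v)" by simp
    then show ?thesis
      unfolding rec E using True le by (simp add: turns_Suc algebra_simps)
  next
    case False
    then have le: "2 * ?v + 1 \<le> i"
      and E: "?E = 2 * fps_X * (4 * fps_X) ^ ?v * (1 + fps_X) ^ (i - 1 - 2 * ?v)"
      using Suc.IH by auto
    from le have "i - 2 * ?v = Suc (i - 1 - 2 * ?v)" by simp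
    then show ?thesis
      unfolding rec E using False le by (simp add: turns_Suc algebra_simps)
  qed
qed

lemma even_gf_peaked:
  fixes up :: "nat \<Rightarrow> bool"
  assumes "up 0" "\<not> up n"
  defines "v \<equiv> turns up n"
  shows "2 * v + 1 \<le> n"
    and "even_gf up (Suc n) =
      fps_const (2 * 4 ^ v) * (fps_X ^ Suc v * ((1 + fps_X) ^ (n - 1 - 2 * v) * inverse ((1 - fps_X) ^ Suc n)))"
    and "even_gf up (Suc n) = fps_const (1/2) *
      ((1 + fps_X) ^ (n + 1) / (1 - fps_X) ^ (n + 1)) * (4 * fps_X / (1 + fps_X) ^ 2) ^ (v + 1)"
proof -
  let ?X = "fps_X :: real fps"
  from even_gf_closed_form[of up n] assms(1,2)
  have le: "2 * v + 1 \<le> n" and E: "(1 - ?X) ^ Suc n * even_gf up (Suc n) =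
           2 * ?X * (4 * ?X) ^ v * (1 + ?X) ^ (n - 1 - 2 * v)"
    by (auto simp: v_def)
  show "2 * v + 1 \<le> n" by (fact le)
  have inv: "inverse ((1 - ?X) ^ Suc n) * (1 - ?X) ^ Suc n = 1"
    by (rule inverse_mult_eq_1) (simp add: fps_power_zeroth)
  have four: "(4 :: real fps) ^ v = fps_const (4 ^ v)" "(2::real fps) = fps_const 2"
    by (simp_all add: numeral_fps_const)
  have "even_gf up (Suc n) =
      inverse ((1 - ?X) ^ Suc n) * ((1 - ?X) ^ Suc n * even_gf up (Suc n))"
    using inv by (metis mult.assoc mult_1)
  also have "\<dots> = 2 * 4 ^ v * (?X ^ Suc v * ((1 + ?X) ^ (n - 1 - 2 * v) * inverse ((1 - ?X) ^ Suc n)))"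
    unfolding E by (simp add: power_mult_distrib mult_ac)
  finally have E1: "even_gf up (Suc n) =
    2 * 4 ^ v * (?X ^ Suc v * ((1 + ?X) ^ (n - 1 - 2 * v) * inverse ((1 - ?X) ^ Suc n)))" .
  then show "even_gf up (Suc n) =
      fps_const (2 * 4 ^ v) * (fps_X ^ Suc v * ((1 + fps_X) ^ (n - 1 - 2 * v) * inverse ((1 - fps_X) ^ Suc n)))"
    unfolding four by (simp del: power_Suc)
  have inv': "inverse ((1 + ?X) ^ 2) ^ (v + 1) * (1 + ?X) ^ (2 * (v + 1)) = 1"
  proof -
    have "inverse ((1 + ?X) ^ 2) * (1 + ?X) ^ 2 = 1"
      by (rule inverse_mult_eq_1) (simp add: fps_power_zeroth)
    then show ?thesis by (metis power_mult power_mult_distrib power_one)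
  qed
  \<comment> \<open>The first factor cancels the denominators of the \<open>v + 1\<close> factors
    \<open>4 * fps_X / (1 + fps_X) ^ 2\<close>.\<close>
  have split: "(1 + ?X) ^ (n + 1) = (1 + ?X) ^ (2 * (v + 1)) * (1 + ?X) ^ (n - 1 - 2 * v)"
    using le by (simp only: flip: power_add) simp
  have u1: "fps_nth ((1 - ?X) ^ (n + 1)) 0 \<noteq> 0" and u2: "fps_nth ((1 + ?X) ^ 2) 0 \<noteq> 0"
    by (simp_all add: fps_power_zeroth)
  have half: "fps_const (1/2) * (4::real fps) ^ (v + 1) = 2 * 4 ^ v"
    by (simp add: numeral_fps_const)
  have "fps_const (1/2) *
      ((1 + ?X) ^ (n + 1) / (1 - ?X) ^ (n + 1)) * (4 * ?X / (1 + ?X) ^ 2) ^ (v + 1) =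
     (fps_const (1/2) * 4 ^ (v + 1)) * (?X ^ Suc v * ((inverse ((1 + ?X) ^ 2) ^ (v + 1) * (1 + ?X) ^ (2 * (v + 1))) *
       ((1 + ?X) ^ (n - 1 - 2 * v) * inverse ((1 - ?X) ^ Suc n))))"
    unfolding split
    by (simp only: fps_divide_unit[OF u1] fps_divide_unit[OF u2] power_mult_distrib mult_ac Suc_eq_plus1)
  also have "\<dots> = even_gf up (Suc n)"
    unfolding inv' E1 half by simp
  finally show "even_gf up (Suc n) = fps_const (1/2) *
      ((1 + fps_X) ^ (n + 1) / (1 - fps_X) ^ (n + 1)) * (4 * fps_X / (1 + fps_X) ^ 2) ^ (v + 1)"
    by simp
qed

section \<open>Extracting coefficients\<close>

lemma nth_binomial_quotient:
  "fps_nth ((1 + fps_X) ^ N * inverse ((1 - fps_X) ^ Suc n)) d =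
     (\<Sum>i=0..d. real (N choose i) * real ((n + (d - i)) choose n))"
proof -
  have "fps_nth ((1 + fps_X :: real fps) ^ N) i = real (N choose i)" for i
    by (simp flip: fps_binomial_of_nat binomial_gbinomial)
  moreover have "fps_nth (inverse ((1 - fps_X :: real fps) ^ Suc n)) i = real ((n + i) choose n)" for i
    using one_minus_const_fps_X_neg_power'[of "Suc n" "1::real"] binomial_symmetric[of i "n + i"]
    by (simp del: power_Suc)
  ultimately show ?thesis
    by (simp add: fps_mult_nth del: power_Suc)
qed

lemma int_binomial_of_nat [simp]: "int_binomial (int k) (int j) = k choose j"
  by (auto simp: int_binomial_def binomial_eq_0)

text \<open>Only \<open>a\<close> with \<open>a >= v\<close> contribute. The substitution
  \<open>a = i + v\<close> gives the Cauchy product at index \<open>m - 1 - v\<close>, the shift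
  being the effect of \<open>fps_X ^ Suc v\<close>. For \<open>m <= v\<close> both sides
  vanish.\<close>

lemma sum_int_binomial:
  assumes "2 * v + 1 \<le> n" "m \<ge> 1"
  shows "(\<Sum>a = 0..m - 1.
      real (int_binomial (int n + int m - int a - 1) (int n)) *
      real (int_binomial (int n - 1 - 2 * int v) (int a - int v))) =
    fps_nth (fps_X ^ Suc v * ((1 + fps_X) ^ (n - 1 - 2 * v) * inverse ((1 - fps_X) ^ Suc n))) m"
    (is "sum ?f _ = _")
proof (cases "v < m")
  case True
  define N where "N = n - 1 - 2 * v"
  have N: "int n - 1 - 2 * int v = int N" using assms by (simp add: N_def)
  have "sum ?f {0..m - 1} = sum ?f {0 + v..(m - 1 - v) + v}"
    using True by (intro sum.mono_neutral_right) (auto simp: int_binomial_def)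
  also have "\<dots> = (\<Sum>i = 0..m - 1 - v. ?f (i + v))"
    by (rule sum.shift_bounds_cl_nat_ivl)
  also have "\<dots> = (\<Sum>i = 0..m - 1 - v. real (N choose i) * real ((n + (m - 1 - v - i)) choose n))"
  proof (rule sum.cong[OF refl])
    fix i assume i: "i \<in> {0..m - 1 - v}"
    have "int n + int m - int (i + v) - 1 = int (n + (m - 1 - v - i))"
      using i True by auto
    moreover have "int (i + v) - int v = int i" by simp
    ultimately show "?f (i + v) = real (N choose i) * real ((n + (m - 1 - v - i)) choose n)"
      by (simp only: N int_binomial_of_nat) (simp only: mult.commute)
  qed
  also have "\<dots> = fps_nth ((1 + fps_X) ^ N * inverse ((1 - fps_X) ^ Suc n)) (m - 1 - v)"
    by (simp only: nth_binomial_quotient)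
  finally show ?thesis
    using True by (simp add: N_def fps_X_power_mult_nth del: power_Suc)
next
  case False
  then have "sum ?f {0..m - 1} = 0"
    using assms by (intro sum.neutral) (auto simp: int_binomial_def)
  then show ?thesis
    using False by (simp add: fps_X_power_mult_nth del: power_Suc)
qed


section \<open>The shuffled deck as a strictly sorted list\<close>

text \<open>The order, from top to bottom, in which the labelling \<open>f\<close> arranges the
  cards.\<close>

definition deck_less :: "(nat \<Rightarrow> nat) \<Rightarrow> nat \<Rightarrow> nat \<Rightarrow> bool" where
  "deck_less f c d \<longleftrightarrow> f c < f d \<or> f c = f d \<and> (if odd (f c) then c < d else d < c)"

lemma transp_deck_less: "transp (deck_less f)"
  by (auto simp: transp_def deck_less_def split: if_splits)

lemma deck_less_irrefl: "\<not> deck_less f c c"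
  by (simp add: deck_less_def)

lemma sorted_wrt_imp_distinct:
  assumes "\<And>x. \<not> P x x" "sorted_wrt P xs"
  shows "distinct xs"
  using assms(2) by (induction xs) (use assms(1) in auto)

text \<open>If the heads differed, each would occur in the tail of the other list and hence precede
  the other, against transitivity and irreflexivity. Totality is not assumed.\<close>

lemma sorted_wrt_unique:
  assumes "transp P" "\<And>x. \<not> P x x"
    and "sorted_wrt P xs" "sorted_wrt P ys" "set xs = set ys"
  shows "xs = ys"
  using assms(3-5)
proof (induction xs arbitrary: ys)
  case Nil
  then show ?case by simp
next
  case (Cons x xs)
  then obtain y ys' where ys: "ys = y # ys'"
    by (cases ys) auto
  have "x = y"
  proof (rule ccontr)
    assume "x \<noteq> y"
    with Cons.prems ys have "P x y" "P y x" by auto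
    with assms(1,2) show False by (meson transpD)
  qed
  moreover have "x \<notin> set xs" "y \<notin> set ys'"
    using Cons.prems ys assms(2) by auto
  ultimately have "set xs = set ys'"
    using Cons.prems(3) ys by auto
  then show ?case
    using Cons ys \<open>x = y\<close> by simp
qed

lemma set_packet: "set (packet n f j) = {c \<in> {1..n}. f c = j}"
  by (auto simp: packet_def Let_def)

lemma sorted_packet: "sorted_wrt (deck_less f) (packet n f j)"
proof -
  let ?cards = "filter (\<lambda>c. f c = j) [1..<Suc n]"
  have sorted: "sorted_wrt (<) ?cards"
    by (intro sorted_wrt_filter sorted_wrt_upt)
  show ?thesis
  proof (cases "odd j")
    case True
    then show ?thesis
      using sorted by (auto simp: packet_def deck_less_def elim!: sorted_wrt_mono_rel[rotated])
  next
    case False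
    then have "sorted_wrt (\<lambda>c d. deck_less f d c) ?cards"
      by (intro sorted_wrt_mono_rel[OF _ sorted]) (auto simp: deck_less_def simp del: upt_Suc)
    then show ?thesis
      using False by (simp add: packet_def Let_def sorted_wrt_rev del: upt_Suc)
  qed
qed

lemma sorted_shelf_deck: "sorted_wrt (deck_less f) (shelf_deck m n f)"
proof -
  have "sorted_wrt (deck_less f) (concat (map (packet n f) [1..<Suc k]))" for k
  proof (induction k)
    case (Suc k)
    then show ?case
      using sorted_packet by (auto simp: sorted_wrt_append set_packet) (simp_all add: deck_less_def)
  qed simp
  then show ?thesis unfolding shelf_deck_def .
qed

lemma set_shelf_deck:
  assumes "f \<in> PiE_dflt {1..n} 0 (\<lambda>_. {1..2 * m})"
  shows "set (shelf_deck m n f) = {1..n}"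
  using assms by (fastforce simp: shelf_deck_def set_packet PiE_dflt_def simp del: upt_Suc)

text \<open>Sortedness for an irreflexive relation excludes repetitions, so the length is the number
  of cards.\<close>

lemma length_shelf_deck:
  assumes "f \<in> PiE_dflt {1..n} 0 (\<lambda>_. {1..2 * m})"
  shows "length (shelf_deck m n f) = n"
  using distinct_card[OF sorted_wrt_imp_distinct[OF deck_less_irrefl sorted_shelf_deck]]
    set_shelf_deck[OF assms] by (metis card_atLeastAtMost diff_Suc_1)

text \<open>By uniqueness of strictly sorted lists, \<open>f\<close> produces \<open>w\<close> iff
  the word of \<open>w\<close> is sorted by \<open>deck_less f\<close>; transitivity reduces this to
  neighbours.\<close>

lemma shelf_perm_eq_iff:
  assumes w: "w permutes {1..n}" and f: "f \<in> PiE_dflt {1..n} 0 (\<lambda>_. {1..2 * m})"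
  shows "shelf_perm m n f = w \<longleftrightarrow> (\<forall>i\<in>{1..<n}. deck_less f (w i) (w (Suc i)))"
proof -
  let ?ws = "map w [1..<Suc n]"
  have nth: "?ws ! i = w (Suc i)" if "i < n" for i
    using that by (simp del: upt_Suc)
  have "shelf_perm m n f = w \<longleftrightarrow> shelf_deck m n f = ?ws"
  proof
    assume eq: "shelf_perm m n f = w"
    show "shelf_deck m n f = ?ws"
    proof (rule nth_equalityI)
      fix i assume "i < length (shelf_deck m n f)"
      then have i: "i < n" by (simp add: length_shelf_deck[OF f])
      with fun_cong[OF eq, of "Suc i"] show "shelf_deck m n f ! i = ?ws ! i"
        unfolding nth[OF i] by (simp add: shelf_perm_def)
    qed (simp add: length_shelf_deck[OF f])
  next
    assume eq: "shelf_deck m n f = ?ws"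
    show "shelf_perm m n f = w"
    proof
      fix i show "shelf_perm m n f i = w i"
        using nth[of "i - 1"] permutes_not_in[OF w, of i]
        by (auto simp: shelf_perm_def eq simp del: upt_Suc)
    qed
  qed
  also have "\<dots> \<longleftrightarrow> sorted_wrt (deck_less f) ?ws"
  proof
    assume sorted: "sorted_wrt (deck_less f) ?ws"
    have "set ?ws = w ` {1..n}" by (simp add: atLeastLessThanSuc_atLeastAtMost del: upt_Suc)
    then have "set (shelf_deck m n f) = set ?ws"
      by (simp only: set_shelf_deck[OF f] permutes_image[OF w])
    with sorted show "shelf_deck m n f = ?ws"
      by (intro sorted_wrt_unique[OF transp_deck_less[of f] deck_less_irrefl sorted_shelf_deck])
  qed (metis sorted_shelf_deck)
  also have "\<dots> \<longleftrightarrow> (\<forall>i. Suc i < n \<longrightarrow> deck_less f (w (Suc i)) (w (Suc (Suc i))))"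
    unfolding sorted_wrt_iff_nth_Suc_transp[OF transp_deck_less] using nth by (auto simp del: upt_Suc nth_map)
  also have "\<dots> \<longleftrightarrow> (\<forall>i\<in>{1..<n}. deck_less f (w i) (w (Suc i)))"
    by (force simp: Ball_def dest: Suc_le_D)
  finally show ?thesis .
qed

section \<open>Labellings producing a permutation as label chains\<close>

text \<open>The word \<open>w\<close> is extended by an initial ascent and a final descent, matching the boundary
  labels \<open>1\<close> (odd, minimal) and \<open>2 * m\<close> (even, maximal), which then impose no constraint.\<close>
definition ascent :: "nat \<Rightarrow> (nat \<Rightarrow> nat) \<Rightarrow> nat \<Rightarrow> bool" where
  "ascent n w i \<longleftrightarrow> i = 0 \<or> i < n \<and> w i < w (Suc i)"

lemma permutes_neq_Suc: "w permutes A \<Longrightarrow> w i \<noteq> w (Suc i)"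
  using permutes_inj[of w A] by (simp add: inj_eq)

text \<open>Between equal labels the packet direction decides: odd requires an ascent of
  \<open>w\<close>, even a descent. Injectivity of \<open>w\<close> turns "no ascent" into
  "descent".\<close>

lemma deck_less_iff_step:
  assumes "w permutes {1..n}" "i \<in> {1..<n}"
  shows "deck_less f (w i) (w (Suc i)) \<longleftrightarrow> step (ascent n w i) (f (w i)) (f (w (Suc i)))"
  using assms permutes_neq_Suc[OF assms(1), of i]
  by (auto simp: deck_less_def step_def ascent_def)

text \<open>A valley at \<open>i\<close> is a turn at \<open>i - 1\<close>. The added steps create
  none: the first is an ascent, so no turn starts at 0, and the last is a descent, so no turn ends
  at \<open>n\<close>.\<close>

lemma turns_ascent:
  assumes w: "w permutes {1..n}"
  shows "turns (ascent n w) n = valleys n w"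
proof -
  let ?T = "{j. j < n \<and> \<not> ascent n w j \<and> ascent n w (Suc j)}"
  have "{i. 1 < i \<and> i < n \<and> w (i - 1) > w i \<and> w i < w (i + 1)} = Suc ` ?T"
  proof (intro equalityI subsetI)
    fix i assume "i \<in> {i. 1 < i \<and> i < n \<and> w (i - 1) > w i \<and> w i < w (i + 1)}"
    then have "i - 1 \<in> ?T" "i = Suc (i - 1)" by (auto simp: ascent_def)
    then show "i \<in> Suc ` ?T" by blast
  next
    fix i assume "i \<in> Suc ` ?T"
    then obtain j where j: "i = Suc j" "j \<in> ?T" by blast
    with permutes_neq_Suc[OF w, of j]
    show "i \<in> {i. 1 < i \<and> i < n \<and> w (i - 1) > w i \<and> w i < w (i + 1)}"
      by (auto simp: ascent_def)
  qed
  then show ?thesis by (simp add: turns_def valleys_def card_image)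
qed

lemma step_imp_le: "step b x y \<Longrightarrow> x \<le> y"
  by (auto simp: step_def)

lemma label_chains_mono:
  assumes "g \<in> label_chains up i k" "a \<le> b" "b \<le> i"
  shows "g a \<le> g b"
  using assms(2,3)
proof (induction b rule: dec_induct)
  case (step b)
  then show ?case
    using assms(1) step_imp_le[of "up b" "g b" "g (Suc b)"] by (force simp: label_chains_def)
qed simp

lemma card_labellings:
  assumes n: "n \<ge> 1" and m: "m \<ge> 1" and w: "w permutes {1..n}"
  shows "card {f \<in> PiE_dflt {1..n} 0 (\<lambda>_. {1..2 * m}). shelf_perm m n f = w} =
           chain_count (ascent n w) (Suc n) (2 * m)"
proof -
  let ?F = "{f \<in> PiE_dflt {1..n} 0 (\<lambda>_. {1..2 * m}). shelf_perm m n f = w}"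
  let ?C = "label_chains (ascent n w) (Suc n) (2 * m)"
  \<comment> \<open>\<open>h\<close> reads the labels along the positions of \<open>w\<close> and
    adds the boundary labels; \<open>h'\<close> reads them back by card.\<close>
  define h where "h = (\<lambda>f i. if i = 0 then 1 else if i = Suc n then 2 * m else f (w i))"
  define h' where "h' = (\<lambda>g c. if c \<in> {1..n} then g (inv w c) else (0 :: nat))"
  have w_in: "w i \<in> {1..n} \<longleftrightarrow> i \<in> {1..n}" for i
    using permutes_in_image[OF w] .
  have inv: "inv w (w i) = i" "w (inv w i) = i" for i
    using permutes_inverses[OF w] by auto
  have inv_in: "inv w i \<in> {1..n} \<longleftrightarrow> i \<in> {1..n}" for i
    using w_in[of "inv w i"] inv(2) by simp
  have F_iff: "f \<in> ?F \<longleftrightarrow> f \<in> PiE_dflt {1..n} 0 (\<lambda>_. {1..2 * m}) \<and>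
      (\<forall>i\<in>{1..<n}. step (ascent n w i) (f (w i)) (f (w (Suc i))))" for f
    using shelf_perm_eq_iff[OF w] deck_less_iff_step[OF w] by auto
  have "bij_betw h ?F ?C"
  proof (rule bij_betwI)
    show "h \<in> ?F \<rightarrow> ?C"
    proof
      fix f assume "f \<in> ?F"
      then have f: "f \<in> PiE_dflt {1..n} 0 (\<lambda>_. {1..2 * m})"
        and st: "\<And>i. i \<in> {1..<n} \<Longrightarrow> step (ascent n w i) (f (w i)) (f (w (Suc i)))"
        unfolding F_iff by auto
      have range: "1 \<le> f (w i)" "f (w i) \<le> 2 * m" if "i \<in> {1..n}" for i
        using f w_in[of i] that by (auto simp: PiE_dflt_def)
      have "step (ascent n w j) (h f j) (h f (Suc j))" if j: "j < Suc n" for j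
      proof -
        consider "j = 0" | "j = n" "j \<noteq> 0" | "j \<in> {1..<n}"
          using j by force
        then show ?thesis
        proof cases
          case 1
          with range(1)[of 1] n show ?thesis
            by (auto simp: h_def step_def ascent_def)
        next
          case 2
          with range(2)[of n] n show ?thesis
            by (auto simp: h_def step_def ascent_def)
        next
          case 3
          with st[of j] show ?thesis by (auto simp: h_def)
        qed
      qed
      moreover have "h f j = 0" if "j > Suc n" for j
        using that f w_in[of j] by (auto simp: h_def PiE_dflt_def)
      ultimately show "h f \<in> ?C"
        by (auto simp: label_chains_def) (auto simp: h_def)
    qed
    show "h' \<in> ?C \<rightarrow> ?F"
    proof
      fix g assume g: "g \<in> ?C"
      have ends: "g 0 = 1" "g (Suc n) = 2 * m" using g by (auto simp: label_chains_def)
      \<comment> \<open>Chains are weakly increasing, so the boundary labels bound every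
        entry.\<close>
      have "g i \<in> {1..2 * m}" if "i \<in> {1..n}" for i
        using label_chains_mono[OF g, of 0 i] label_chains_mono[OF g, of i "Suc n"] that ends by auto
      then have "h' g \<in> PiE_dflt {1..n} 0 (\<lambda>_. {1..2 * m})"
        using inv_in by (auto simp: h'_def PiE_dflt_def)
      moreover have "h' g (w i) = g i" if "i \<in> {1..n}" for i
        using that w_in[of i] by (simp add: h'_def inv)
      ultimately show "h' g \<in> ?F"
        unfolding F_iff using g by (auto simp: label_chains_def)
    qed
    show "h' (h f) = f" if "f \<in> ?F" for f
    proof
      have f: "f \<in> PiE_dflt {1..n} 0 (\<lambda>_. {1..2 * m})" using that by simp
      fix c show "h' (h f) c = f c"
      proof (cases "c \<in> {1..n}")
        case True
        then have "inv w c \<noteq> 0" "inv w c \<noteq> Suc n" using inv_in[of c] by auto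
        with True show ?thesis by (simp add: h'_def h_def inv)
      next
        case False
        with f show ?thesis by (auto simp: h'_def PiE_dflt_def)
      qed
    qed
    show "h (h' g) = g" if "g \<in> ?C" for g
    proof
      fix i show "h (h' g) i = g i"
      proof (cases "i \<in> {1..n}")
        case True
        with w_in[of i] have "h' g (w i) = g i" by (simp add: h'_def inv)
        with True show ?thesis by (simp add: h_def)
      next
        case False
        then have "i = 0 \<or> i = Suc n \<or> Suc n < i" by auto
        moreover have "h' g (w i) = 0" using False w_in[of i] by (auto simp: h'_def)
        ultimately show ?thesis using that by (auto simp: h_def label_chains_def)
      qed
    qed
  qed
  then show ?thesis
    by (simp only: bij_betw_same_card card_label_chains)
qed

section \<open>The probability of a permutation\<close>

text \<open>Independent uniform labels form a uniform labelling among \<open>(2 * m) ^ n\<close>.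
  The favourable ones are chains ending in \<open>2 * m\<close>, counted by the coefficient of
  \<open>even_gf\<close> at \<open>m\<close>.\<close>

lemma pmf_shelf_shuffle:
  assumes "n \<ge> 1" "m \<ge> 1" "w permutes {1..n}"
  shows "pmf (shelf_shuffle m n) w =
    1 / (2 * real m) ^ n * fps_nth (even_gf (ascent n w) (Suc n)) m"
proof -
  let ?P = "PiE_dflt {1..n} (0::nat) (\<lambda>_. {1..2 * m})"
  have fin: "finite ?P" by auto
  have card: "card ?P = (2 * m) ^ n" by (subst card_PiE_dflt) auto
  with assms have ne: "?P \<noteq> {}" by (metis card.empty mult_eq_0_iff not_one_le_zero power_not_zero zero_neq_numeral)
  have "shelf_shuffle m n = map_pmf (shelf_perm m n) (pmf_of_set ?P)"
    unfolding shelf_shuffle_def using assms by (subst Pi_pmf_of_set) auto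
  then have "pmf (shelf_shuffle m n) w = card (?P \<inter> shelf_perm m n -` {w}) / card ?P"
    using fin ne by (simp add: pmf_map measure_pmf_of_set)
  also have "?P \<inter> shelf_perm m n -` {w} = {f \<in> ?P. shelf_perm m n f = w}" by auto
  finally show ?thesis
    unfolding card card_labellings[OF assms] by (simp add: even_gf_def)
qed

theorem theorem3p1:
  fixes n m :: nat and w :: "nat \<Rightarrow> nat"
  assumes "n \<ge> 1" and "m \<ge> 1" and "w permutes {1..n}"
  shows "pmf (shelf_shuffle m n) w =
           4 ^ (valleys n w + 1) / (2 * (2 * real m) ^ n) *
           (\<Sum>a = 0..m - 1.
              real (int_binomial (int n + int m - int a - 1) (int n)) *
              real (int_binomial (int n - 1 - 2 * int (valleys n w)) (int a - int (valleys n w))))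
       \<and> pmf (shelf_shuffle m n) w =
           fps_nth
             (fps_const (1 / (2 * (2 * real m) ^ n)) *
              ((1 + fps_X) ^ (n + 1) / (1 - fps_X) ^ (n + 1)) *
              (4 * fps_X / (1 + fps_X) ^ 2) ^ (valleys n w + 1)) m"
proof -
  \<comment> \<open>Since \<open>n >= 1\<close>, the final descent at \<open>n\<close> does not
    collide with the initial ascent at 0.\<close>
  have up: "ascent n w 0" "\<not> ascent n w n"
    using assms(1) by (auto simp: ascent_def)
  note gf = even_gf_peaked[OF up, unfolded turns_ascent[OF assms(3)]]
  have const: "fps_const (1 / (2 * (2 * real m) ^ n)) =
      fps_const (1 / (2 * real m) ^ n) * fps_const (1/2)"
    by simp
  have scale: "1 / p * (2 * 4 ^ v * x) = 4 ^ (v + 1) / (2 * p) * x" for p x :: real and v :: nat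
    by simp
  show ?thesis
  proof (intro conjI)
    show "pmf (shelf_shuffle m n) w =
           4 ^ (valleys n w + 1) / (2 * (2 * real m) ^ n) *
           (\<Sum>a = 0..m - 1.
              real (int_binomial (int n + int m - int a - 1) (int n)) *
              real (int_binomial (int n - 1 - 2 * int (valleys n w)) (int a - int (valleys n w))))"
      unfolding sum_int_binomial[OF gf(1) assms(2)] pmf_shelf_shuffle[OF assms] gf(2)
        fps_mult_left_const_nth scale ..
    show "pmf (shelf_shuffle m n) w =
           fps_nth
             (fps_const (1 / (2 * (2 * real m) ^ n)) *
              ((1 + fps_X) ^ (n + 1) / (1 - fps_X) ^ (n + 1)) *
              (4 * fps_X / (1 + fps_X) ^ 2) ^ (valleys n w + 1)) m"
      unfolding pmf_shelf_shuffle[OF assms] gf(3) const mult.assoc fps_mult_left_const_nth ..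
  qed
qed

end
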